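(* Let $q\ge1$ be an integer, let $a,b$ be real numbers with $b\ne0$ and $b(q+1)-a\ge2|b|\sqrt q$, and let $w,v:T_{q+1}\to\mathbb R$ belong to $L^2(T_{q+1})$. The solution $w_{q+1}^{a,b}(x;t)$ of the discrete wave equation $$\Delta_{q+1}^{a,b}w_{q+1}^{a,b}(x;t)+\partial_t^2w_{q+1}^{a,b}(x;t)=0,\qquad x\in T_{q+1},\ t\in\mathbb N_0,$$ satisfying the initial conditions $w_{q+1}^{a,b}(x;0)=w(x)$ and $\partial_tw_{q+1}^{a,b}(x;0)=v(x)$ for all $x\in T_{q+1}$ is given, at time $t\in\mathbb N_0$, by $$w_{q+1}^{a,b}(x;t)=\sum_{r=0}^{\lfloor t/2\rfloor}\ \sum_{y\in T_{q+1}:\,d(x,y)=r}\left(W_{q+1}^{a,b}(r;t)\,w(y)+V_{q+1}^{a,b}(r;t)\,v(y)\right),\qquad x\in T_{q+1}.$$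
   Context: $T_{q+1}$ is the $(q+1)$-regular tree (identified with its vertex set) with a fixed root $x_0$ and graph distance $d$; $L^2$ is with respect to counting measure. $\Delta_{T_{q+1}}f(x)=(q+1)f(x)-\sum_{y\sim x}f(y)$ and $\Delta_{q+1}^{a,b}=b\Delta_{T_{q+1}}-aI$, acting in the space variable. $\partial_tf(t)=f(t+1)-f(t)$ and $\partial_t^2f(t)=f(t+2)-2f(t+1)+f(t)$. Wave kernels: $W_{q+1}^{a,b}$ and $V_{q+1}^{a,b}$ are the solutions of $\Delta_{q+1}^{a,b}U(x;t)+\partial_t^2U(x;t)=0$ with, for all $x$, $W_{q+1}^{a,b}(x;0)=\delta_{x_0}(x)$, $\partial_tW_{q+1}^{a,b}(x;0)=0$, respectively $V_{q+1}^{a,b}(x;0)=0$, $\partial_tV_{q+1}^{a,b}(x;0)=\delta_{x_0}(x)$, where $\delta_{x_0}(x)=1$ if $x=x_0$ and $0$ otherwise. They depend on $x$ only through $r=d(x_0,x)$ and are written $W_{q+1}^{a,b}(r;t)$, $V_{q+1}^{a,b}(r;t)$. *)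

theory Defs
  imports "HOL-Analysis.Analysis"
begin

section \<open>Regular trees\<close>

text \<open>
  A simple graph is given by its adjacency relation; its vertices are all elements of the type
  \<open>'v\<close>. The notion \<open>tree\<close> of the AFP entry \<open>Graph_Theory\<close> is not usable here, because
  it excludes directed cycles only, so that a symmetric digraph with an arc is never a tree.
\<close>

definition simple_graph :: "('v \<Rightarrow> 'v \<Rightarrow> bool) \<Rightarrow> bool" where
  "simple_graph adj \<longleftrightarrow> symp adj \<and> irreflp adj"

definition graph_cycle :: "('v \<Rightarrow> 'v \<Rightarrow> bool) \<Rightarrow> 'v list \<Rightarrow> bool" where
  "graph_cycle adj c \<longleftrightarrow>
     3 \<le> length c \<and> distinct c \<and> successively adj c \<and> adj (last c) (hd c)"

definition tree_graph :: "('v \<Rightarrow> 'v \<Rightarrow> bool) \<Rightarrow> bool" where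
  "tree_graph adj \<longleftrightarrow> simple_graph adj \<and> (\<forall>x y. adj\<^sup>*\<^sup>* x y) \<and> (\<nexists>c. graph_cycle adj c)"

text \<open>
  The cardinality of an infinite set is \<open>0\<close>, so for \<open>k > 0\<close> the last conjunct also says
  that the graph is locally finite.
\<close>

definition regular_tree :: "nat \<Rightarrow> ('v \<Rightarrow> 'v \<Rightarrow> bool) \<Rightarrow> bool" where
  "regular_tree k adj \<longleftrightarrow> tree_graph adj \<and> (\<forall>x. card {y. adj x y} = k)"

definition graph_dist :: "('v \<Rightarrow> 'v \<Rightarrow> bool) \<Rightarrow> 'v \<Rightarrow> 'v \<Rightarrow> nat" where
  "graph_dist adj x y = (LEAST n. (adj ^^ n) x y)"

definition in_L2 :: "('v \<Rightarrow> real) \<Rightarrow> bool" where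
  "in_L2 f \<longleftrightarrow> integrable (count_space UNIV) (\<lambda>x. (f x)\<^sup>2)"


section \<open>The discrete wave equation\<close>

definition laplacian :: "('v \<Rightarrow> 'v \<Rightarrow> bool) \<Rightarrow> nat \<Rightarrow> ('v \<Rightarrow> real) \<Rightarrow> 'v \<Rightarrow> real" where
  "laplacian adj q f x = real (q + 1) * f x - (\<Sum>y | adj x y. f y)"

definition laplacian_ab ::
    "('v \<Rightarrow> 'v \<Rightarrow> bool) \<Rightarrow> nat \<Rightarrow> real \<Rightarrow> real \<Rightarrow> ('v \<Rightarrow> real) \<Rightarrow> 'v \<Rightarrow> real" where
  "laplacian_ab adj q a b f x = b * laplacian adj q f x - a * f x"

definition time_diff :: "(nat \<Rightarrow> real) \<Rightarrow> nat \<Rightarrow> real" where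
  "time_diff f t = f (t + 1) - f t"

definition time_diff2 :: "(nat \<Rightarrow> real) \<Rightarrow> nat \<Rightarrow> real" where
  "time_diff2 f t = f (t + 2) - 2 * f (t + 1) + f t"

definition is_wave_solution ::
    "('v \<Rightarrow> 'v \<Rightarrow> bool) \<Rightarrow> nat \<Rightarrow> real \<Rightarrow> real \<Rightarrow> ('v \<Rightarrow> real) \<Rightarrow> ('v \<Rightarrow> real)
      \<Rightarrow> ('v \<Rightarrow> nat \<Rightarrow> real) \<Rightarrow> bool" where
  "is_wave_solution adj q a b f g u \<longleftrightarrow>
     (\<forall>x t. laplacian_ab adj q a b (\<lambda>y. u y t) x + time_diff2 (u x) t = 0) \<and>
     (\<forall>x. u x 0 = f x) \<and>
     (\<forall>x. time_diff (u x) 0 = g x)"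

text \<open>The equation is a two-step recursion in time, so the initial data determine the solution.\<close>

fun wave_rec ::
    "('v \<Rightarrow> 'v \<Rightarrow> bool) \<Rightarrow> nat \<Rightarrow> real \<Rightarrow> real \<Rightarrow> ('v \<Rightarrow> real) \<Rightarrow> ('v \<Rightarrow> real)
      \<Rightarrow> nat \<Rightarrow> 'v \<Rightarrow> real" where
  "wave_rec adj q a b f g 0 = f"
| "wave_rec adj q a b f g (Suc 0) = (\<lambda>x. f x + g x)"
| "wave_rec adj q a b f g (Suc (Suc t)) = (\<lambda>x. 2 * wave_rec adj q a b f g (Suc t) x
     - wave_rec adj q a b f g t x - laplacian_ab adj q a b (wave_rec adj q a b f g t) x)"

lemma is_wave_solution_iff_wave_rec:
  "is_wave_solution adj q a b f g u \<longleftrightarrow> u = (\<lambda>x t. wave_rec adj q a b f g t x)"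
proof
  assume u: "is_wave_solution adj q a b f g u"
  have "(\<lambda>x. u x t) = wave_rec adj q a b f g t" for t
  proof (induction t rule: induct_nat_012)
    case 0
    then show ?case using u by (auto simp: is_wave_solution_def)
  next
    case 1
    have "u x (Suc 0) = f x + g x" for x
    proof -
      have "u x 0 = f x" "time_diff (u x) 0 = g x"
        using u by (auto simp: is_wave_solution_def)
      then show ?thesis by (simp add: time_diff_def)
    qed
    then show ?case by auto
  next
    case (ge2 t)
    have "u x (Suc (Suc t)) = 2 * u x (Suc t) - u x t - laplacian_ab adj q a b (\<lambda>y. u y t) x" for x
    proof -
      have "laplacian_ab adj q a b (\<lambda>y. u y t) x + time_diff2 (u x) t = 0"
        using u by (auto simp: is_wave_solution_def)
      then show ?thesis by (simp add: time_diff2_def)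
    qed
    with ge2 show ?case by (auto simp: fun_eq_iff)
  qed
  then show "u = (\<lambda>x t. wave_rec adj q a b f g t x)"
    by (metis (mono_tags))
qed (auto simp: is_wave_solution_def time_diff_def time_diff2_def)

lemma ex1_wave_solution: "\<exists>!u. is_wave_solution adj q a b f g u"
  by (simp add: is_wave_solution_iff_wave_rec)

definition wave_solution ::
    "('v \<Rightarrow> 'v \<Rightarrow> bool) \<Rightarrow> nat \<Rightarrow> real \<Rightarrow> real \<Rightarrow> ('v \<Rightarrow> real) \<Rightarrow> ('v \<Rightarrow> real)
      \<Rightarrow> 'v \<Rightarrow> nat \<Rightarrow> real" where
  "wave_solution adj q a b f g = (THE u. is_wave_solution adj q a b f g u)"

lemma is_wave_solution_wave_solution:
  "is_wave_solution adj q a b f g (wave_solution adj q a b f g)"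
  unfolding wave_solution_def using ex1_wave_solution by (rule theI')


section \<open>Wave kernels\<close>

definition delta :: "'v \<Rightarrow> 'v \<Rightarrow> real" where
  "delta x0 x = (if x = x0 then 1 else 0)"

definition kernel_W ::
    "('v \<Rightarrow> 'v \<Rightarrow> bool) \<Rightarrow> nat \<Rightarrow> real \<Rightarrow> real \<Rightarrow> 'v \<Rightarrow> 'v \<Rightarrow> nat \<Rightarrow> real" where
  "kernel_W adj q a b x0 = wave_solution adj q a b (delta x0) (\<lambda>x. 0)"

definition kernel_V ::
    "('v \<Rightarrow> 'v \<Rightarrow> bool) \<Rightarrow> nat \<Rightarrow> real \<Rightarrow> real \<Rightarrow> 'v \<Rightarrow> 'v \<Rightarrow> nat \<Rightarrow> real" where
  "kernel_V adj q a b x0 = wave_solution adj q a b (\<lambda>x. 0) (delta x0)"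

text \<open>
  The value of a function, radial about \<open>x0\<close>, on the sphere of radius \<open>r\<close>. It is meaningful
  only if \<open>U\<close> is constant on that sphere; in a regular tree of degree at least \<open>2\<close> the
  spheres are nonempty and both kernels are radial.
\<close>

definition radial_value :: "('v \<Rightarrow> 'v \<Rightarrow> bool) \<Rightarrow> 'v \<Rightarrow> ('v \<Rightarrow> nat \<Rightarrow> real) \<Rightarrow> nat \<Rightarrow> nat \<Rightarrow> real" where
  "radial_value adj x0 U r t = (THE c. \<forall>x. graph_dist adj x0 x = r \<longrightarrow> U x t = c)"

definition radial_W ::
    "('v \<Rightarrow> 'v \<Rightarrow> bool) \<Rightarrow> nat \<Rightarrow> real \<Rightarrow> real \<Rightarrow> 'v \<Rightarrow> nat \<Rightarrow> nat \<Rightarrow> real" where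
  "radial_W adj q a b x0 = radial_value adj x0 (kernel_W adj q a b x0)"

definition radial_V ::
    "('v \<Rightarrow> 'v \<Rightarrow> bool) \<Rightarrow> nat \<Rightarrow> real \<Rightarrow> real \<Rightarrow> 'v \<Rightarrow> nat \<Rightarrow> nat \<Rightarrow> real" where
  "radial_V adj q a b x0 = radial_value adj x0 (kernel_V adj q a b x0)"

end

theory Submission
  imports Defs
begin

text \<open>
  The formula is a superposition principle combined with the homogeneity of the tree.

  The wave equation is linear and advances two time steps for each application of the adjacency
  operator. So on any locally finite connected graph the solution at \<open>(x;t)\<close> is a finite combination
  of the initial data at the vertices \<open>y\<close> within distance \<open>\<lfloor>t/2\<rfloor>\<close> of \<open>x\<close>, with coefficients the
  solutions started from \<open>\<delta>\<^sub>y\<close> and evaluated at \<open>x\<close> (\<open>wave_rec_superposition\<close>).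

  It remains to see that these coefficients are \<open>W(d(x,y);t)\<close> and \<open>V(d(x,y);t)\<close>, although the
  kernels are defined with the root \<open>x\<^sub>0\<close> as source. In a tree every vertex other than the source
  has exactly one neighbour that is closer to the source, and all its other neighbours are farther
  away: two vertices on the same sphere are joined through the interior of the sphere, so
  an edge within a sphere, or a second closer neighbour, would close a cycle. In the regular tree the
  number of neighbours in each direction is therefore determined by the distance alone, hence the
  Laplacian acts on functions of the distance to the source by a recursion that does not refer to
  the source (\<open>laplacian_ab_radial\<close>). Consequently the kernels are functions of the distance and
  time, the same for every source (\<open>wave_rec_radial\<close>).
\<close>

section \<open>Distance in a connected graph\<close>

locale connected_graph =
  fixes adj :: "'v \<Rightarrow> 'v \<Rightarrow> bool"
  assumes adj_sym: "adj x y \<Longrightarrow> adj y x"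
    and connected: "adj\<^sup>*\<^sup>* x y"
begin

abbreviation d :: "'v \<Rightarrow> 'v \<Rightarrow> nat" where
  "d \<equiv> graph_dist adj"

lemma relpowp_dist: "(adj ^^ d x y) x y"
proof -
  obtain n where "(adj ^^ n) x y"
    using rtranclp_imp_relpowp[OF connected] by blast
  then show ?thesis
    unfolding graph_dist_def by (rule LeastI)
qed

lemma dist_le: "(adj ^^ n) x y \<Longrightarrow> d x y \<le> n"
  unfolding graph_dist_def by (rule Least_le)

lemma dist_eq_0_iff [simp]: "d x y = 0 \<longleftrightarrow> x = y"
  using relpowp_dist[of x y] dist_le[of 0 x y] by auto

lemma dist_commute: "d x y = d y x"
proof -
  have "(adj ^^ n) y x" if "(adj ^^ n) x y" for n x y
    using that
  proof (induction n arbitrary: y)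
    case (Suc n)
    then obtain z where "(adj ^^ n) x z" "adj z y" by auto
    with Suc.IH show ?case by (blast intro: relpowp_Suc_I2 adj_sym)
  qed auto
  then show ?thesis
    using dist_le relpowp_dist by (intro antisym) blast+
qed

lemma dist_adj: "adj x z \<Longrightarrow> d y z \<le> Suc (d y x)"
  using relpowp_dist[of y x] by (auto intro!: dist_le)

lemma closer_neighbour:
  assumes "d y x = Suc n"
  obtains z where "adj x z" "d y z = n"
proof -
  from relpowp_dist[of y x] assms obtain z where z: "(adj ^^ n) y z" "adj z x"
    by auto
  have "d y z = n"
    using dist_le[OF z(1)] dist_adj[OF z(2), of y] assms by simp
  with z that adj_sym show thesis by blast
qed

lemma finite_ball:
  assumes fin: "\<And>x. finite {z. adj x z}"
  shows "finite {y. d x y \<le> n}"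
proof (induction n)
  case (Suc n)
  have "{y. d x y \<le> Suc n} \<subseteq> {y. d x y \<le> n} \<union> (\<Union>z\<in>{y. d x y \<le> n}. {y. adj z y})"
  proof
    fix y assume y: "y \<in> {y. d x y \<le> Suc n}"
    show "y \<in> {y. d x y \<le> n} \<union> (\<Union>z\<in>{y. d x y \<le> n}. {y. adj z y})"
    proof (cases "d x y = Suc n")
      case True
      then obtain z where "adj y z" "d x z = n" by (rule closer_neighbour)
      then have "adj z y" "d x z \<le> n" by (auto intro: adj_sym)
      then show ?thesis by blast
    qed (use y in auto)
  qed
  with Suc fin show ?case by (meson finite_UN finite_Un finite_subset)
qed auto

text \<open>
  Geodesics from \<open>u\<close> and from \<open>v\<close> towards \<open>y\<close> end in the same vertex; cut off where they meet
  first, they form a simple path. Its inner vertices lie strictly inside the sphere of \<open>u\<close> and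
  \<open>v\<close>, but the weaker bound suffices for the induction, in which the endpoints are
  one level above the path already constructed.
\<close>

lemma path_inside_sphere:
  assumes "u \<noteq> v" "d y u = n" "d y v = n"
  obtains p where "3 \<le> length p" "distinct p" "successively adj p" "hd p = u" "last p = v"
    "\<forall>z\<in>set p. d y z \<le> n"
  using assms
proof (induction n arbitrary: u v thesis)
  case 0
  then show ?case by simp
next
  case (Suc n)
  obtain u' where u': "adj u u'" "d y u' = n" using closer_neighbour Suc.prems by blast
  obtain v' where v': "adj v v'" "adj v' v" "d y v' = n" using closer_neighbour Suc.prems adj_sym by metis
  show ?case
  proof (cases "u' = v'")
    case True
    show ?thesis
      by (rule Suc.prems(1)[of "[u, u', v]"]) (use True u' v' Suc.prems in auto)
  next
    case False
    from Suc.IH[OF _ False u'(2) v'(3)] obtain p where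
      p: "3 \<le> length p" "distinct p" "successively adj p" "hd p = u'" "last p = v'"
        "\<forall>z\<in>set p. d y z \<le> n" by blast
    have "u \<notin> set p" "v \<notin> set p" "p \<noteq> []" using p Suc.prems by auto
    then show ?thesis
      by (intro Suc.prems(1)[of "u # p @ [v]"])
         (use p u' v' Suc.prems in
           \<open>auto simp: successively_append_iff successively_Cons le_Suc_eq\<close>)
  qed
qed

end


section \<open>Spheres in a regular tree\<close>

locale homogeneous_tree =
  fixes adj :: "'v \<Rightarrow> 'v \<Rightarrow> bool" and q :: nat
  assumes tree: "regular_tree (q + 1) adj" and q_pos: "1 \<le> q"

sublocale homogeneous_tree \<subseteq> connected_graph
  using tree by unfold_locales
    (auto simp: regular_tree_def tree_graph_def simple_graph_def dest: sympD)

context homogeneous_tree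
begin

lemma no_cycle: "\<not> graph_cycle adj c"
  using tree by (auto simp: regular_tree_def tree_graph_def)

lemma card_neighbours: "card {z. adj x z} = q + 1"
  using tree by (auto simp: regular_tree_def)

lemma finite_neighbours: "finite {z. adj x z}"
  using card_neighbours[of x] by (intro card_ge_0_finite) simp

lemma adj_imp_dist_neq:
  assumes "adj u v"
  shows "d y u \<noteq> d y v"
proof
  assume "d y u = d y v"
  moreover have "u \<noteq> v"
    using assms tree by (auto simp: regular_tree_def tree_graph_def simple_graph_def irreflp_def)
  ultimately obtain p where "3 \<le> length p" "distinct p" "successively adj p" "hd p = u" "last p = v"
    using path_inside_sphere by metis
  with adj_sym[OF assms] have "graph_cycle adj p" by (simp add: graph_cycle_def)
  with no_cycle show False by blast
qed

lemma closer_neighbour_unique: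
  assumes "adj x u" "adj x v" "d y u = n" "d y v = n" "d y x = Suc n"
  shows "u = v"
proof (rule ccontr)
  assume "u \<noteq> v"
  then obtain p where p: "3 \<le> length p" "distinct p" "successively adj p" "hd p = u" "last p = v"
    "\<forall>z\<in>set p. d y z \<le> n"
    using path_inside_sphere assms by metis
  then have "x \<notin> set p" "p \<noteq> []" using assms by auto
  with p assms(1) adj_sym[OF assms(2)] have "graph_cycle adj (p @ [x])"
    by (auto simp: graph_cycle_def successively_append_iff)
  with no_cycle show False by blast
qed

lemma farther_neighbours:
  assumes "d y x = Suc n"
  obtains z0 where "adj x z0" "d y z0 = n" "\<And>z. adj x z \<Longrightarrow> z \<noteq> z0 \<Longrightarrow> d y z = Suc (Suc n)"
proof -
  obtain z0 where z0: "adj x z0" "d y z0 = n" using closer_neighbour assms by blast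
  have "d y z = Suc (Suc n)" if "adj x z" "z \<noteq> z0" for z
  proof -
    have "d y z \<noteq> n" using closer_neighbour_unique z0 that assms by blast
    moreover have "d y z \<noteq> Suc n" using adj_imp_dist_neq[OF that(1), of y] assms by simp
    moreover have "d y z \<le> Suc (Suc n)" using dist_adj[OF that(1), of y] assms by simp
    moreover have "Suc n \<le> Suc (d y z)" using dist_adj[OF adj_sym[OF that(1)], of y] assms by simp
    ultimately show ?thesis by simp
  qed
  with z0 that show thesis by blast
qed

text \<open>
  Because the degree is at least \<open>2\<close>, a vertex on one sphere has a neighbour other than the single
  one that leads back, and that neighbour lies on the next sphere.
\<close>

lemma sphere_nonempty: "\<exists>x. d y x = r"
proof (induction r)
  case 0
  show ?case by (intro exI[of _ y]) simp
next
  case (Suc r)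
  then obtain x where x: "d y x = r" by blast
  show ?case
  proof (cases r)
    case 0
    obtain z where z: "adj x z"
      using card_neighbours[of x] by (metis add_is_0 card.empty empty_Collect_eq one_neq_zero)
    from z have "d y z \<le> Suc 0" "d y z \<noteq> 0"
      using dist_adj[OF z, of y] adj_imp_dist_neq[OF z, of y] x 0 by (simp_all del: dist_eq_0_iff)
    with 0 show ?thesis by (intro exI[of _ z]) linarith
  next
    case (Suc n)
    with x obtain z0 where z0: "\<And>z. adj x z \<Longrightarrow> z \<noteq> z0 \<Longrightarrow> d y z = Suc (Suc n)"
      using farther_neighbours by metis
    have "\<not> {z. adj x z} \<subseteq> {z0}"
      using card_mono[of "{z0}" "{z. adj x z}"] card_neighbours[of x] q_pos by auto
    then obtain z where "adj x z" "z \<noteq> z0" by blast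
    with z0 Suc show ?thesis by blast
  qed
qed


section \<open>Radial functions and the wave kernels\<close>

lemma sum_neighbours_radial:
  "(\<Sum>z | adj x z. \<phi> (d y z)) =
    (if d y x = 0 then (real q + 1) * \<phi> 1 else \<phi> (d y x - 1) + real q * \<phi> (d y x + 1))"
proof (cases "d y x")
  case 0
  have "d y z = 1" if "adj x z" for z
    using dist_adj[OF that, of y] adj_imp_dist_neq[OF that, of y] 0
    by (simp del: dist_eq_0_iff)
  then have "(\<Sum>z | adj x z. \<phi> (d y z)) = (\<Sum>z | adj x z. \<phi> 1)"
    by (intro sum.cong) auto
  with 0 show ?thesis using card_neighbours[of x] by (simp add: algebra_simps)
next
  case (Suc n)
  then obtain z0 where z0: "adj x z0" "d y z0 = n"
    "\<And>z. adj x z \<Longrightarrow> z \<noteq> z0 \<Longrightarrow> d y z = Suc (Suc n)"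
    using farther_neighbours by metis
  have "(\<Sum>z | adj x z. \<phi> (d y z)) = \<phi> (d y z0) + (\<Sum>z\<in>{z. adj x z} - {z0}. \<phi> (d y z))"
    using z0 finite_neighbours by (intro sum.remove) auto
  also have "(\<Sum>z\<in>{z. adj x z} - {z0}. \<phi> (d y z)) = (\<Sum>z\<in>{z. adj x z} - {z0}. \<phi> (Suc (Suc n)))"
    using z0 by (intro sum.cong) auto
  finally show ?thesis
    using Suc z0 card_neighbours[of x] by (simp add: card_Diff_singleton)
qed

text \<open>
  What matters is the order of the quantifiers: the resulting profile \<open>\<psi>\<close> does not
  depend on the centre \<open>y\<close>.
\<close>

lemma laplacian_ab_radial:
  "\<exists>\<psi>. \<forall>y x. laplacian_ab adj q a b (\<lambda>z. \<phi> (d y z)) x = \<psi> (d y x)"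
  unfolding laplacian_ab_def laplacian_def sum_neighbours_radial
  by (rule exI[of _ "\<lambda>r. b * (real (q + 1) * \<phi> r -
       (if r = 0 then (real q + 1) * \<phi> 1 else \<phi> (r - 1) + real q * \<phi> (r + 1))) - a * \<phi> r"]) simp

lemma wave_rec_radial:
  "\<exists>\<psi>. \<forall>y x. wave_rec adj q a b (\<lambda>z. \<phi> (d y z)) (\<lambda>z. \<gamma> (d y z)) t x = \<psi> (d y x)"
proof (induction t rule: induct_nat_012)
  case 0
  show ?case by auto
next
  case 1
  show ?case by (auto intro: exI[of _ "\<lambda>r. \<phi> r + \<gamma> r"])
next
  case (ge2 t)
  obtain \<psi>0 where 0: "\<And>y. wave_rec adj q a b (\<lambda>z. \<phi> (d y z)) (\<lambda>z. \<gamma> (d y z)) t = (\<lambda>x. \<psi>0 (d y x))"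
    using ge2(1) by (auto simp: fun_eq_iff)
  obtain \<psi>1 where 1: "\<And>y. wave_rec adj q a b (\<lambda>z. \<phi> (d y z)) (\<lambda>z. \<gamma> (d y z)) (Suc t) =
      (\<lambda>x. \<psi>1 (d y x))"
    using ge2(2) by (auto simp: fun_eq_iff)
  obtain \<psi>2 where 2: "\<And>y x. laplacian_ab adj q a b (\<lambda>z. \<psi>0 (d y z)) x = \<psi>2 (d y x)"
    using laplacian_ab_radial by blast
  show ?case
    by (rule exI[of _ "\<lambda>r. 2 * \<psi>1 r - \<psi>0 r - \<psi>2 r"]) (simp add: 0 1 2)
qed

lemma radial_value_eq:
  assumes "\<And>x. U x t = \<psi> (d x0 x)"
  shows "radial_value adj x0 U r t = \<psi> r"
  unfolding radial_value_def using sphere_nonempty[of x0 r] assms by (intro the_equality) auto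

lemma wave_solution_eq: "wave_solution adj q a b f g x t = wave_rec adj q a b f g t x"
  using is_wave_solution_wave_solution[of adj q a b f g]
  by (simp add: is_wave_solution_iff_wave_rec)

lemma delta_radial: "delta y = (\<lambda>z. if d y z = 0 then 1 else 0)"
  by (auto simp: delta_def)

lemma radial_W_eq: "radial_W adj q a b x0 (d y x) t = wave_rec adj q a b (delta y) (\<lambda>x. 0) t x"
proof -
  obtain \<psi> where "\<And>y x. wave_rec adj q a b (delta y) (\<lambda>x. 0) t x = \<psi> (d y x)"
    using wave_rec_radial[of a b "\<lambda>r. if r = 0 then 1 else 0" "\<lambda>r. 0" t]
    unfolding delta_radial by blast
  then show ?thesis
    unfolding radial_W_def kernel_W_def
    by (simp add: radial_value_eq[of _ t \<psi>] wave_solution_eq)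
qed

lemma radial_V_eq: "radial_V adj q a b x0 (d y x) t = wave_rec adj q a b (\<lambda>x. 0) (delta y) t x"
proof -
  obtain \<psi> where "\<And>y x. wave_rec adj q a b (\<lambda>x. 0) (delta y) t x = \<psi> (d y x)"
    using wave_rec_radial[of a b "\<lambda>r. 0" "\<lambda>r. if r = 0 then 1 else 0" t]
    unfolding delta_radial by blast
  then show ?thesis
    unfolding radial_V_def kernel_V_def
    by (simp add: radial_value_eq[of _ t \<psi>] wave_solution_eq)
qed

end


section \<open>Superposition\<close>

lemma laplacian_ab_sum:
  "laplacian_ab adj q a b (\<lambda>z. \<Sum>y\<in>B. F y z) x = (\<Sum>y\<in>B. laplacian_ab adj q a b (F y) x)"
  unfolding laplacian_ab_def laplacian_def
  by (subst sum.swap) (simp add: sum_subtractf sum_distrib_left right_diff_distrib)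

lemma laplacian_ab_add:
  "laplacian_ab adj q a b (\<lambda>z. f z + g z) x =
    laplacian_ab adj q a b f x + laplacian_ab adj q a b g x"
  by (simp add: laplacian_ab_def laplacian_def sum.distrib algebra_simps)

lemma laplacian_ab_cmult:
  "laplacian_ab adj q a b (\<lambda>z. c * f z) x = c * laplacian_ab adj q a b f x"
  by (simp add: laplacian_ab_def laplacian_def sum_distrib_left[symmetric] algebra_simps)

lemma laplacian_ab_cong:
  assumes "f x = g x" "\<And>z. adj x z \<Longrightarrow> f z = g z"
  shows "laplacian_ab adj q a b f x = laplacian_ab adj q a b g x"
  using assms by (simp add: laplacian_ab_def laplacian_def)

text \<open>
  The sum extends over an arbitrary finite set containing the ball of radius \<open>\<lfloor>t/2\<rfloor>\<close>, because the
  induction step needs one and the same set for \<open>x\<close> and its neighbours, whose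
  balls for time \<open>t\<close> all lie in the ball of \<open>x\<close> for time \<open>t + 2\<close>.
\<close>

lemma (in connected_graph) wave_rec_superposition:
  assumes "finite B" "{y. d x y \<le> t div 2} \<subseteq> B"
  shows "wave_rec adj q a b f g t x =
    (\<Sum>y\<in>B. f y * wave_rec adj q a b (delta y) (\<lambda>x. 0) t x +
           g y * wave_rec adj q a b (\<lambda>x. 0) (delta y) t x)"
  using assms(2)
proof (induction t arbitrary: x rule: induct_nat_012)
  case 0
  then have "x \<in> B" by auto
  with assms(1) show ?case by (simp add: delta_def mult_delta_right)
next
  case 1
  then have "x \<in> B" by auto
  with assms(1) show ?case by (simp add: delta_def sum.distrib mult_delta_right)
next
  case (ge2 t)
  let ?W = "\<lambda>y. wave_rec adj q a b (delta y) (\<lambda>x. 0)"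
  let ?V = "\<lambda>y. wave_rec adj q a b (\<lambda>x. 0) (delta y)"
  have near: "{y. d z y \<le> t div 2} \<subseteq> B" if "z = x \<or> adj x z" for z
  proof
    fix y assume "y \<in> {y. d z y \<le> t div 2}"
    moreover have "d x y \<le> Suc (d z y)"
      using that dist_adj[of z x y] adj_sym[of x z] by (auto simp: dist_commute)
    ultimately have "d x y \<le> Suc (Suc t) div 2" by simp
    with ge2.prems show "y \<in> B" by auto
  qed
  have "{y. d x y \<le> Suc t div 2} \<subseteq> B"
    using ge2.prems by (auto dest: subsetD)
  then have step1: "wave_rec adj q a b f g (Suc t) x =
      (\<Sum>y\<in>B. f y * ?W y (Suc t) x + g y * ?V y (Suc t) x)"
    by (rule ge2.IH(2))
  have step0: "wave_rec adj q a b f g t z = (\<Sum>y\<in>B. f y * ?W y t z + g y * ?V y t z)"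
    if "z = x \<or> adj x z" for z
    by (rule ge2.IH(1)[OF near[OF that]])
  have "laplacian_ab adj q a b (wave_rec adj q a b f g t) x =
      laplacian_ab adj q a b (\<lambda>z. \<Sum>y\<in>B. f y * ?W y t z + g y * ?V y t z) x"
    by (rule laplacian_ab_cong) (use step0 in auto)
  also have "\<dots> = (\<Sum>y\<in>B. f y * laplacian_ab adj q a b (?W y t) x +
      g y * laplacian_ab adj q a b (?V y t) x)"
    by (simp add: laplacian_ab_sum laplacian_ab_add laplacian_ab_cmult)
  finally have lap: "laplacian_ab adj q a b (wave_rec adj q a b f g t) x =
      (\<Sum>y\<in>B. f y * laplacian_ab adj q a b (?W y t) x + g y * laplacian_ab adj q a b (?V y t) x)" .
  show ?case
    unfolding wave_rec.simps lap step1 step0[OF disjI1[OF refl]] sum_distrib_left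
      sum_subtractf[symmetric]
    by (rule sum.cong[OF refl]) (simp add: algebra_simps)
qed


section \<open>The solution in terms of the wave kernels\<close>

theorem corollary4p1:
  fixes adj :: "'v \<Rightarrow> 'v \<Rightarrow> bool" and x0 :: 'v
    and q :: nat and a b :: real and w v :: "'v \<Rightarrow> real"
  assumes "1 \<le> q"
    and "regular_tree (q + 1) adj"
    and "b \<noteq> 0"
    and "b * (real q + 1) - a \<ge> 2 * \<bar>b\<bar> * sqrt (real q)"
    and "in_L2 w"
    and "in_L2 v"
  shows "\<forall>x t. wave_solution adj q a b w v x t =
    (\<Sum>r = 0..t div 2. \<Sum>y | graph_dist adj x y = r.
       radial_W adj q a b x0 r t * w y + radial_V adj q a b x0 r t * v y)"
proof (intro allI)
  fix x t
  interpret homogeneous_tree adj q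
    using assms by unfold_locales
  let ?B = "{y. d x y \<le> t div 2}"
  let ?k = "\<lambda>r y. radial_W adj q a b x0 r t * w y + radial_V adj q a b x0 r t * v y"
  have fin: "finite ?B"
    using finite_ball[OF finite_neighbours] .
  have "wave_solution adj q a b w v x t = (\<Sum>y\<in>?B. ?k (d x y) y)"
    unfolding wave_solution_eq
    by (subst wave_rec_superposition[OF fin order_refl], rule sum.cong[OF refl])
       (simp add: dist_commute[of x] radial_W_eq radial_V_eq mult.commute)
  also have "\<dots> = (\<Sum>r = 0..t div 2. \<Sum>y | y \<in> ?B \<and> d x y = r. ?k (d x y) y)"
    by (rule sum.group[symmetric]) (use fin in auto)
  also have "\<dots> = (\<Sum>r = 0..t div 2. \<Sum>y | d x y = r. ?k r y)"
    by (intro sum.cong) auto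
  finally show "wave_solution adj q a b w v x t = (\<Sum>r = 0..t div 2. \<Sum>y | d x y = r. ?k r y)" .
qed

end
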